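(* For any integers $v\ge w\ge t\ge 2$, $$M_t(w,v)\ge \binom{v}{\lceil w/t^2\rceil}\Big/\binom{w}{\lceil w/t^2\rceil}^2.$$
   Context: A set system is a pair $(\mathcal{X},\mathcal{B})$ where $\mathcal{X}$ is a finite set of points and $\mathcal{B}$ is a collection (set) of subsets of $\mathcal{X}$ called blocks; its size is $|\mathcal{B}|$. $\binom{\mathcal{X}}{w}$ denotes the collection of all $w$-subsets of $\mathcal{X}$. A $t$-traceability scheme $t$-TS$(w,v)$ is a set system $(\mathcal{X},\mathcal{B})$ with $|\mathcal{X}|=v$ and $\mathcal{B}\subseteq\binom{\mathcal{X}}{w}$ such that for every choice of $s$ blocks $B_1,\ldots,B_s\in\mathcal{B}$ with $1\le s\le t$ and for any $w$-subset $T\subseteq\bigcup_{1\le j\le s}B_j$, there does not exist a block $B\in\mathcal{B}\setminus\{B_1,\ldots,B_s\}$ such that $|T\cap B|\ge|T\cap B_j|$ for all $1\le j\le s$. $M_t(w,v)$ denotes the maximum size of a $t$-TS$(w,v)$. *)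

theory Defs
  imports Complex_Main
begin

definition set_system :: "'a set \<Rightarrow> 'a set set \<Rightarrow> bool" where
  "set_system X \<B> \<longleftrightarrow> finite X \<and> \<B> \<subseteq> Pow X"

text \<open>The blocks chosen are the values \<open>C 1, \<dots>, C s\<close>. They are not required to be distinct:
  a choice with repetitions imposes the same condition as the choice of its distinct members,
  of which there are again between 1 and \<open>t\<close>.\<close>

definition traceability_scheme ::
  "nat \<Rightarrow> nat \<Rightarrow> nat \<Rightarrow> 'a set \<Rightarrow> 'a set set \<Rightarrow> bool" where
  "traceability_scheme t w v X \<B> \<longleftrightarrow>
     set_system X \<B> \<and> card X = v \<and> \<B> \<subseteq> {B. B \<subseteq> X \<and> card B = w} \<and>
     (\<forall>s C. 1 \<le> s \<and> s \<le> t \<and> C ` {1..s} \<subseteq> \<B> \<longrightarrow>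
        (\<forall>T. T \<subseteq> (\<Union>j\<in>{1..s}. C j) \<and> card T = w \<longrightarrow>
           \<not> (\<exists>B\<in>\<B> - C ` {1..s}. \<forall>j\<in>{1..s}. card (T \<inter> B) \<ge> card (T \<inter> C j))))"

text \<open>Every finite point set is in bijection with a set of natural numbers, so taking the points
  to be natural numbers loses no generality.\<close>

definition traceability_sizes :: "nat \<Rightarrow> nat \<Rightarrow> nat \<Rightarrow> nat set" where
  "traceability_sizes t w v =
     {card \<B> | (X :: nat set) \<B>. traceability_scheme t w v X \<B>}"

definition max_traceability :: "nat \<Rightarrow> nat \<Rightarrow> nat \<Rightarrow> nat" where
  "max_traceability t w v = Max (traceability_sizes t w v)"

text \<open>The maximum is taken over a finite nonempty set.\<close>

lemma finite_traceability_sizes: "finite (traceability_sizes t w v)"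
proof (rule finite_subset)
  show "traceability_sizes t w v \<subseteq> {..v choose w}"
  proof
    fix n assume "n \<in> traceability_sizes t w v"
    then obtain X :: "nat set" and \<B> where n: "n = card \<B>" and X: "finite X" "card X = v"
      and \<B>: "\<B> \<subseteq> {B. B \<subseteq> X \<and> card B = w}"
      by (auto simp: traceability_sizes_def traceability_scheme_def set_system_def)
    have "card \<B> \<le> card {B. B \<subseteq> X \<and> card B = w}"
      using X \<B> by (intro card_mono) auto
    then show "n \<in> {..v choose w}"
      using n X n_subsets[of X w] by simp
  qed
qed simp

lemma traceability_sizes_nonempty: "traceability_sizes t w v \<noteq> {}"
proof -
  have "traceability_scheme t w v {..<v} {}"
    by (auto simp: traceability_scheme_def set_system_def)
  then show ?thesis
    unfolding traceability_sizes_def by blast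
qed

end

theory Submission
  imports Defs
begin

text \<open>Put \<open>k = \<lceil>w/t\<^sup>2\<rceil>\<close>. If distinct blocks meet in fewer than \<open>k\<close> points, hence in fewer than
  \<open>w/t\<^sup>2\<close>, then a further block meets \<open>T\<close> in fewer than \<open>t \<cdot> w/t\<^sup>2 = w/t\<close> points, while some
  \<open>B\<^sub>j\<close> meets it in at least \<open>w/t\<close> by pigeonhole. A maximal such packing is large, because every
  \<open>w\<close>-set shares a \<open>k\<close>-subset with one of its blocks.\<close>

definition packing :: "nat \<Rightarrow> nat \<Rightarrow> 'a set \<Rightarrow> 'a set set \<Rightarrow> bool" where
  "packing k w X \<B> \<longleftrightarrow> \<B> \<subseteq> {B. B \<subseteq> X \<and> card B = w} \<and>
     (\<forall>A\<in>\<B>. \<forall>B\<in>\<B>. A \<noteq> B \<longrightarrow> card (A \<inter> B) < k)"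

text \<open>The last hypothesis is \<open>k - 1 < w / t\<^sup>2\<close> cleared of denominators. A
  factor \<open>t\<close> is lost twice: once when at most \<open>t\<close> blocks cover
  \<open>T \<inter> D\<close> for a rival \<open>D\<close>, and once when they cover
  \<open>T\<close> itself.\<close>

lemma packing_imp_traceability_scheme:
  assumes X: "finite X" "card X = v" and P: "packing k w X \<B>"
    and k: "t\<^sup>2 * (k - 1) < w"
  shows "traceability_scheme t w v X \<B>"
proof -
  have B: "\<B> \<subseteq> {B. B \<subseteq> X \<and> card B = w}"
    using P by (simp add: packing_def)
  have I: "card (A \<inter> B) \<le> k - 1" if "A \<in> \<B>" "B \<in> \<B>" "A \<noteq> B" for A B
  proof -
    have "card (A \<inter> B) < k"
      using P that by (simp add: packing_def)
    then show ?thesis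
      by simp
  qed
  have no_rival: False
    if s: "1 \<le> s" "s \<le> t" and C: "C ` {1..s} \<subseteq> \<B>"
      and T: "T \<subseteq> (\<Union>j\<in>{1..s}. C j)" "card T = w"
      and D: "D \<in> \<B> - C ` {1..s}"
      and le: "\<forall>j\<in>{1..s}. card (T \<inter> C j) \<le> card (T \<inter> D)"
    for s C T D
  proof -
    have finC: "finite (C j)" if "j \<in> {1..s}" for j
    proof -
      have "C j \<subseteq> X"
        using that C B by blast
      then show ?thesis
        using X(1) finite_subset by blast
    qed
    \<comment> \<open>\<open>D\<close> differs from every \<open>C j\<close>, so each
      \<open>C j\<close> accounts for at most \<open>k - 1\<close> points of
      \<open>T \<inter> D\<close>.\<close>
    have "T \<inter> D \<subseteq> (\<Union>j\<in>{1..s}. C j \<inter> D)"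
      using T(1) by blast
    then have "card (T \<inter> D) \<le> card (\<Union>j\<in>{1..s}. C j \<inter> D)"
      using finC by (intro card_mono) auto
    also have "\<dots> \<le> (\<Sum>j\<in>{1..s}. card (C j \<inter> D))"
      by (intro card_UN_le) simp
    also have "\<dots> \<le> (\<Sum>j\<in>{1..s}. k - 1)"
      using C D by (intro sum_mono I) auto
    also have "\<dots> \<le> t * (k - 1)"
      using s by simp
    finally have TD: "card (T \<inter> D) \<le> t * (k - 1)" .
    \<comment> \<open>Pigeonhole in summed form: the \<open>C j\<close> cover \<open>T\<close>, and
      by \<open>le\<close> none of them meets \<open>T\<close> in more points than \<open>D\<close>
      does.\<close>
    have "T = (\<Union>j\<in>{1..s}. T \<inter> C j)"
      using T(1) by blast
    then have "w = card (\<Union>j\<in>{1..s}. T \<inter> C j)"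
      using T(2) by argo
    also have "\<dots> \<le> (\<Sum>j\<in>{1..s}. card (T \<inter> C j))"
      by (intro card_UN_le) simp
    also have "\<dots> \<le> (\<Sum>j\<in>{1..s}. t * (k - 1))"
      using le TD by (intro sum_mono) force
    also have "\<dots> \<le> t * (t * (k - 1))"
      using s by simp
    finally show False
      using k by (simp add: power2_eq_square algebra_simps)
  qed
  show ?thesis
    unfolding traceability_scheme_def set_system_def
  proof (intro conjI allI impI notI)
    show "\<B> \<subseteq> Pow X"
      using B by blast
  next
    fix s C T
    assume "1 \<le> s \<and> s \<le> t \<and> C ` {1..s} \<subseteq> \<B>"
      and "T \<subseteq> (\<Union>j\<in>{1..s}. C j) \<and> card T = w"
      and "\<exists>D\<in>\<B> - C ` {1..s}. \<forall>j\<in>{1..s}. card (T \<inter> C j) \<le> card (T \<inter> D)"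
    then show False
      by (elim conjE bexE) (rule no_rival)
  qed (rule X B)+
qed

lemma card_supersets_of_card:
  assumes "finite X" "K \<subseteq> X" "card K \<le> w"
  shows "card {B. K \<subseteq> B \<and> B \<subseteq> X \<and> card B = w} = (card X - card K) choose (w - card K)"
proof -
  have finK: "finite K"
    using assms finite_subset by blast
  have "bij_betw (\<lambda>B. B - K) {B. K \<subseteq> B \<and> B \<subseteq> X \<and> card B = w}
     {C. C \<subseteq> X - K \<and> card C = w - card K}"
  proof (rule bij_betw_byWitness[where f' = "\<lambda>C. C \<union> K"])
    show "(\<lambda>C. C \<union> K) ` {C. C \<subseteq> X - K \<and> card C = w - card K} \<subseteq>
        {B. K \<subseteq> B \<and> B \<subseteq> X \<and> card B = w}"
    proof (rule image_subsetI)
      fix C assume "C \<in> {C. C \<subseteq> X - K \<and> card C = w - card K}"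
      moreover from this have "card (C \<union> K) = card C + card K"
        using assms finK by (intro card_Un_disjoint) (auto intro: finite_subset)
      ultimately show "C \<union> K \<in> {B. K \<subseteq> B \<and> B \<subseteq> X \<and> card B = w}"
        using assms by auto
    qed
    show "(\<lambda>B. B - K) ` {B. K \<subseteq> B \<and> B \<subseteq> X \<and> card B = w} \<subseteq>
        {C. C \<subseteq> X - K \<and> card C = w - card K}"
      using finK by (auto simp: card_Diff_subset)
  qed blast+
  then show ?thesis
    using assms finK by (simp add: bij_betw_same_card n_subsets card_Diff_subset)
qed

text \<open>A union bound: each such \<open>B\<close> extends some \<open>k\<close>-subset of
  \<open>A\<close>. It is counted once for every \<open>k\<close>-subset of
  \<open>A \<inter> B\<close>, so only an inequality results.\<close>

lemma card_neighbourhood_le: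
  assumes "finite X" "A \<subseteq> X" "card A = w" "k \<le> w"
  shows "card {B. B \<subseteq> X \<and> card B = w \<and> k \<le> card (A \<inter> B)}
    \<le> (w choose k) * ((card X - k) choose (w - k))"
proof -
  let ?N = "\<lambda>K. {B. K \<subseteq> B \<and> B \<subseteq> X \<and> card B = w}"
  let ?K = "{K. K \<subseteq> A \<and> card K = k}"
  have finA: "finite A"
    using assms finite_subset by blast
  have "{B. B \<subseteq> X \<and> card B = w \<and> k \<le> card (A \<inter> B)} \<subseteq> (\<Union>K\<in>?K. ?N K)"
  proof clarify
    fix B assume "B \<subseteq> X" "w = card B" "k \<le> card (A \<inter> B)"
    moreover from this obtain K where "K \<subseteq> A \<inter> B" "card K = k"
      using obtain_subset_with_card_n by metis
    ultimately show "B \<in> (\<Union>K\<in>?K. {B'. K \<subseteq> B' \<and> B' \<subseteq> X \<and> card B' = card B})"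
      by auto
  qed
  then have "card {B. B \<subseteq> X \<and> card B = w \<and> k \<le> card (A \<inter> B)} \<le> card (\<Union>K\<in>?K. ?N K)"
    using assms finA by (intro card_mono) auto
  also have "\<dots> \<le> (\<Sum>K\<in>?K. card (?N K))"
    using finA by (intro card_UN_le) simp
  also have "\<dots> = (\<Sum>K\<in>?K. (card X - k) choose (w - k))"
    using assms by (intro sum.cong) (auto simp: card_supersets_of_card)
  also have "\<dots> = (w choose k) * ((card X - k) choose (w - k))"
    using finA assms by (simp add: n_subsets)
  finally show ?thesis .
qed

text \<open>A Gilbert-Varshamov argument. One factor \<open>w choose k\<close> counts the
  \<open>k\<close>-subsets of a block in the neighbourhood bound; the other appears on passing from
  \<open>card X choose w\<close> to \<open>card X choose k\<close>.\<close>

lemma ex_large_packing: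
  assumes X: "finite X" and "k \<le> w" "w \<le> card X"
  shows "\<exists>\<B>. packing k w X \<B> \<and> (card X choose k) \<le> card \<B> * (w choose k)\<^sup>2"
proof -
  let ?W = "{B. B \<subseteq> X \<and> card B = w}"
  have finW: "finite ?W"
    using X by simp
  have "finite {\<B>. packing k w X \<B>}"
    by (rule finite_subset[of _ "Pow ?W"]) (use finW in \<open>auto simp: packing_def\<close>)
  moreover have "packing k w X {}"
    by (simp add: packing_def)
  \<comment> \<open>Maximality under inclusion is enough, since it is only used to rule out adding a
    single set.\<close>
  ultimately obtain \<B> where P: "packing k w X \<B>"
    and max: "\<And>\<C>. packing k w X \<C> \<Longrightarrow> \<B> \<subseteq> \<C> \<Longrightarrow> \<C> = \<B>"
    using finite_has_maximal[of "{\<B>. packing k w X \<B>}"] by blast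
  have sub: "\<B> \<subseteq> ?W"
    using P by (simp add: packing_def)
  have finB: "finite \<B>"
    using sub finW finite_subset by blast
  let ?N = "\<lambda>A. {B. B \<subseteq> X \<and> card B = w \<and> k \<le> card (A \<inter> B)}"
  have "?W \<subseteq> (\<Union>A\<in>\<B>. ?N A)"
  proof
    fix B assume B: "B \<in> ?W"
    \<comment> \<open>Otherwise \<open>B\<close> could be added to the packing, so by maximality it
      is already a block.\<close>
    have "\<exists>A\<in>\<B>. k \<le> card (A \<inter> B)"
    proof (rule ccontr)
      assume "\<not> ?thesis"
      then have far: "\<And>A. A \<in> \<B> \<Longrightarrow> card (A \<inter> B) < k"
        by force
      then have "packing k w X (insert B \<B>)"
        using P B by (auto simp: packing_def Int_commute)
      then have "B \<in> \<B>"
        using max by blast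
      \<comment> \<open>Taking \<open>A = B\<close> in \<open>far\<close> gives
        \<open>w < k\<close>, against \<open>k \<le> w\<close>.\<close>
      then show False
        using far[of B] B assms by simp
    qed
    then show "B \<in> (\<Union>A\<in>\<B>. ?N A)"
      using B by auto
  qed
  then have "card ?W \<le> card (\<Union>A\<in>\<B>. ?N A)"
    using X finB by (intro card_mono) auto
  also have "\<dots> \<le> (\<Sum>A\<in>\<B>. card (?N A))"
    using finB by (rule card_UN_le)
  also have "\<dots> \<le> (\<Sum>A\<in>\<B>. (w choose k) * ((card X - k) choose (w - k)))"
    using sub assms by (intro sum_mono card_neighbourhood_le) auto
  finally have W: "(card X choose w) \<le> card \<B> * ((w choose k) * ((card X - k) choose (w - k)))"
    using X by (simp add: n_subsets)
  \<comment> \<open>Both sides count pairs of a \<open>k\<close>-set inside a \<open>w\<close>-set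
    inside \<open>X\<close>. Multiplying \<open>W\<close> by \<open>w choose k\<close> thus puts
    \<open>(card X - k) choose (w - k)\<close> on both sides, to be cancelled.\<close>
  have "(card X choose k) * ((card X - k) choose (w - k)) = (card X choose w) * (w choose k)"
    using choose_mult[of k w "card X"] assms by simp
  also have "\<dots> \<le> card \<B> * ((w choose k) * ((card X - k) choose (w - k))) * (w choose k)"
    using W by (rule mult_right_mono) simp
  also have "\<dots> = (card \<B> * (w choose k)\<^sup>2) * ((card X - k) choose (w - k))"
    by (simp only: power2_eq_square mult_ac)
  finally have "(card X choose k) * ((card X - k) choose (w - k))
      \<le> (card \<B> * (w choose k)\<^sup>2) * ((card X - k) choose (w - k))" .
  \<comment> \<open>This is where \<open>w \<le> card X\<close> enters.\<close>
  moreover have "((card X - k) choose (w - k)) > 0"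
    using assms by (simp add: diff_le_mono)
  ultimately have "(card X choose k) \<le> card \<B> * (w choose k)\<^sup>2"
    by (metis mult_le_cancel2)
  then show ?thesis
    using P by blast
qed

theorem theoremV9:
  fixes t w v :: nat
  assumes "v \<ge> w" and "w \<ge> t" and "t \<ge> 2"
  shows "real (max_traceability t w v) \<ge>
    real (v choose nat \<lceil>real w / (real t)^2\<rceil>) / (real (w choose nat \<lceil>real w / (real t)^2\<rceil>))^2"
proof -
  define k where "k = nat \<lceil>real w / (real t)^2\<rceil>"
  \<comment> \<open>Positivity forces \<open>k \<ge> 1\<close>, so the truncated
    \<open>k - 1\<close> is the true predecessor and lies strictly below the quotient.\<close>
  have "real w / (real t)^2 > 0"
    using assms by simp
  then have "real (k - 1) < real w / (real t)^2"
    unfolding k_def by linarith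
  then have "real (t\<^sup>2 * (k - 1)) < real w"
    using assms by (simp add: field_simps)
  then have k: "t\<^sup>2 * (k - 1) < w"
    by linarith
  \<comment> \<open>With \<open>k\<close> this gives \<open>k - 1 < w\<close>, hence
    \<open>k \<le> w\<close>, which both the packing bound and the nonzero denominator
    require.\<close>
  have "k - 1 \<le> t\<^sup>2 * (k - 1)"
    using assms by simp
  with k have "k \<le> w"
    by linarith
  then obtain \<B> :: "nat set set" where P: "packing k w {..<v} \<B>"
    and le: "(v choose k) \<le> card \<B> * (w choose k)\<^sup>2"
    using ex_large_packing[of "{..<v}" k w] assms by auto
  have "traceability_scheme t w v {..<v} \<B>"
    using packing_imp_traceability_scheme[OF _ _ P k] by simp
  then have "card \<B> \<in> traceability_sizes t w v"
    unfolding traceability_sizes_def by blast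
  then have "card \<B> \<le> max_traceability t w v"
    unfolding max_traceability_def using finite_traceability_sizes by (rule Max_ge[rotated])
  with le have "(v choose k) \<le> max_traceability t w v * (w choose k)\<^sup>2"
    by (meson le_trans mult_le_mono1)
  then have "real (v choose k) \<le> real (max_traceability t w v) * (real (w choose k))\<^sup>2"
    by (metis of_nat_le_iff of_nat_mult of_nat_power)
  moreover have "w choose k > 0"
    using \<open>k \<le> w\<close> by simp
  ultimately have "real (v choose k) / (real (w choose k))\<^sup>2 \<le> real (max_traceability t w v)"
    by (simp add: divide_le_eq)
  then show ?thesis
    unfolding k_def .
qed

end
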